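(* Let $A,B,C$ be real numbers with $A>0$, $B>0$ and $AB-C^{2}=\tfrac14$, and let $f$ be the probability density function on $\left]-\tfrac{\pi}{2},\tfrac{\pi}{2}\right[$ given by $$f(\theta)=\frac{1}{2\pi}\,\frac{1}{A\cos^{2}\theta-2C\sin\theta\cos\theta+B\sin^{2}\theta},\qquad \theta\in\left]-\tfrac{\pi}{2},\tfrac{\pi}{2}\right[.$$ For $n\in\{1,2\}$ write $\mathbb{E}[\theta^{n}]=\int_{-\pi/2}^{\pi/2}\theta^{n}f(\theta)\,d\theta$. Then $$\mathbb{E}[\theta]=\arctan\frac{2C}{2B+1},$$ $$\mathbb{E}[\theta^{2}]=\frac{\pi^{2}}{12}+\operatorname{Re}\left[\operatorname{Li}_{2}\left(1-\frac{4B}{1+2B-2iC}\right)\right],$$ where $\operatorname{Li}_{2}(z)=\sum_{k\ge 1}z^{k}/k^{2}$ is the dilogarithm function. The variance is then $\operatorname{Var}(\theta)=\mathbb{E}[\theta^{2}]-\mathbb{E}[\theta]^{2}$.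
   Context: Here $i$ is the imaginary unit, $\operatorname{Re}$ denotes the real part, $\arctan$ of a real number is the principal value in $\left]-\tfrac{\pi}{2},\tfrac{\pi}{2}\right[$, and $\operatorname{Li}_2$ is the principal branch of the dilogarithm, given by the series $\sum_{k\ge1} z^k/k^2$ for $|z|\le 1$. The density $f$ is the polar-angle density (two-dimensional angular central Gaussian distribution) of a centred bivariate Gaussian vector $(q,p)$ with $A=\langle p^2\rangle$, $B=\langle q^2\rangle$, $C=\langle qp\rangle$ and covariance determinant $AB-C^2=\tfrac14$, where $q=r\cos\theta$, $p=r\sin\theta$ and angles are taken modulo $\pi$ with representatives in $\left]-\tfrac{\pi}{2},\tfrac{\pi}{2}\right[$. *)

theory Defs
  imports "HOL-Probability.Probability"
begin

definition angle_range :: "real set" where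
  "angle_range = {- (pi / 2)<..<pi / 2}"

text \<open>Density of the polar angle (modulo \<open>pi\<close>) of a centred Gaussian vector \<open>(q, p)\<close> with
  \<open>A = E[p^2]\<close>, \<open>B = E[q^2]\<close>, \<open>C = E[q p]\<close> and \<open>A * B - C^2 = 1/4\<close>. It is the density only on
  \<^const>\<open>angle_range\<close>; the formula itself is \<open>pi\<close>-periodic, so every integral below is restricted.\<close>

definition polar_angle_density :: "real \<Rightarrow> real \<Rightarrow> real \<Rightarrow> real \<Rightarrow> real" where
  "polar_angle_density A B C \<theta> =
     1 / (2 * pi) * (1 / (A * (cos \<theta>)\<^sup>2 - 2 * C * sin \<theta> * cos \<theta> + B * (sin \<theta>)\<^sup>2))"

definition polar_angle_distribution :: "real \<Rightarrow> real \<Rightarrow> real \<Rightarrow> real measure" where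
  "polar_angle_distribution A B C =
     density lborel (\<lambda>\<theta>. ennreal (indicator angle_range \<theta> * polar_angle_density A B C \<theta>))"

definition polar_angle_moment :: "real \<Rightarrow> real \<Rightarrow> real \<Rightarrow> nat \<Rightarrow> real" where
  "polar_angle_moment A B C n = (LBINT \<theta>:angle_range. \<theta> ^ n * polar_angle_density A B C \<theta>)"

text \<open>The series represents the principal branch of the dilogarithm only for \<open>norm z \<le> 1\<close>; outside
  that disc the value below is meaningless. By \<open>norm_dilog_argument_less_1\<close>, the argument used in
  the second moment always lies in the open unit disc.\<close>

definition dilog :: "complex \<Rightarrow> complex" where
  "dilog z = (\<Sum>k. z ^ Suc k / of_nat (Suc k) ^ 2)"

lemma norm_dilog_argument_less_1:
  fixes B C :: real
  assumes "B > 0"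
  shows "norm (1 - 4 * of_real B / (1 + 2 * of_real B - 2 * \<i> * of_real C) :: complex) < 1"
proof -
  define w :: complex where "w = 1 + 2 * of_real B - 2 * \<i> * of_real C"
  have Re: "Re w = 1 + 2 * B" and Im: "Im w = - 2 * C"
    by (simp_all add: w_def)
  have nz: "w \<noteq> 0"
    using Re assms by auto
  have "(norm (w - 4 * of_real B))\<^sup>2 < (norm w)\<^sup>2"
    using assms unfolding cmod_power2 by (simp add: Re Im power2_eq_square algebra_simps)
  hence "norm (w - 4 * of_real B) < norm w"
    by (rule power2_less_imp_less) simp
  moreover have "1 - 4 * of_real B / w = (w - 4 * of_real B) / w"
    using nz by (simp add: diff_divide_distrib)
  ultimately have "norm (1 - 4 * of_real B / w) < 1"
    using nz by (simp add: norm_divide)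
  thus ?thesis
    by (simp add: w_def)
qed

end

theory Submission
  imports Defs
begin

text \<open>
  The density is a Poisson kernel in disguise. Let
  \<open>z = 1 - 4 B / (1 + 2 B - 2 \<i> C)\<close> be the argument of the dilogarithm, which lies in the open
  unit disc, and let \<open>E(\<theta>) = cis (pi - 2 \<theta>) = - exp (- 2 \<i> \<theta>)\<close>. The condition
  \<open>A B - C\<^sup>2 = 1/4\<close> gives
  \<open>f(\<theta>) = (2 Re (1 / (1 - z E(\<theta>))) - 1) / pi\<close>
  (lemma \<open>polar_angle_density_eq_Poisson_kernel\<close>). Expanding \<open>1 / (1 - z E)\<close> into a geometric
  series, which converges uniformly, and integrating term by term
  (\<open>has_integral_geometric_series\<close>) turns every moment of the angle into a power series in \<open>z\<close>
  whose coefficients are the integrals of \<open>\<theta>\<^sup>n E(\<theta>)\<^sup>k\<close> (\<open>polar_angle_moment_eq_series\<close>).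

  The minus sign in \<open>E\<close> makes \<open>E = 1\<close> at both endpoints, so that integration by parts yields
  coefficients without alternating signs. For \<open>k \<ge> 1\<close> they are \<open>0\<close>, \<open>\<i> pi / (2 k)\<close> and
  \<open>pi / (2 k\<^sup>2)\<close> for \<open>n = 0, 1, 2\<close>. Hence the total mass is \<open>1\<close>; the mean is
  \<open>Re (- \<i> ln (1 - z)) = Im (ln (1 - z))\<close>, an argument of the complex number
  \<open>1 - z = 4 B / (1 + 2 B - 2 \<i> C)\<close>, whose real part is positive; and the second moment is the
  uniform one, \<open>pi\<^sup>2 / 12\<close>, plus the real part of the dilogarithm series.
\<close>

section \<open>The density as a Poisson kernel\<close>

text \<open>Completing the square in \<open>B\<close> times the quadratic form leaves
  \<open>(A B - C\<^sup>2) cos\<^sup>2 \<theta> = cos\<^sup>2 \<theta> / 4\<close>; the factor \<open>16\<close> clears denominators.\<close>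

lemma polar_angle_form_pos:
  fixes A B C \<theta> :: real
  assumes "A > 0" "B > 0" "A * B - C\<^sup>2 = 1 / 4"
  shows "A * (cos \<theta>)\<^sup>2 - 2 * C * sin \<theta> * cos \<theta> + B * (sin \<theta>)\<^sup>2 > 0" (is "?D > 0")
proof -
  have eq: "16 * (B * ?D) = 4 * (cos \<theta>)\<^sup>2 + (4 * (B * sin \<theta> - C * cos \<theta>))\<^sup>2"
    using assms(3) by algebra
  have "4 * (cos \<theta>)\<^sup>2 + (4 * (B * sin \<theta> - C * cos \<theta>))\<^sup>2 > 0"
  proof (cases "cos \<theta> = 0")
    case True
    then have "sin \<theta> \<noteq> 0"
      using sin_cos_squared_add[of \<theta>] by auto
    with True assms(2) show ?thesis
      by simp
  next
    case False
    then show ?thesis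
      by (simp add: add_pos_nonneg)
  qed
  then have "16 * (B * ?D) > 0"
    by (simp only: eq)
  then show ?thesis
    using assms(2) by (simp only: zero_less_mult_iff) auto
qed

text \<open>With \<open>w = 1 + 2 B - 2 \<i> C\<close> and \<open>D\<close> the quadratic form in the density, the number
  \<open>d = w exp (\<i> \<theta>) (1 - z E(\<theta>))\<close> is \<open>2 cos \<theta> + 4 \<i> (B sin \<theta> - C cos \<theta>)\<close>. Its squared modulus is
  \<open>16 B D\<close>, by the same completion of the square as above, so \<open>D\<close> appears in the denominator of the
  real part of \<open>exp (\<i> \<theta>) w / d\<close>.\<close>

lemma polar_angle_density_eq_Poisson_kernel:
  fixes A B C \<theta> :: real
  assumes "A > 0" "B > 0" "A * B - C\<^sup>2 = 1 / 4"
  defines "z \<equiv> 1 - 4 * of_real B / (1 + 2 * of_real B - 2 * \<i> * of_real C) :: complex"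
  shows "polar_angle_density A B C \<theta> = (2 * Re (1 / (1 - z * cis (pi - 2 * \<theta>))) - 1) / pi"
proof -
  define s c where "s = sin \<theta>" and "c = cos \<theta>"
  define D where "D = A * c\<^sup>2 - 2 * C * s * c + B * s\<^sup>2"
  have D: "D > 0"
    using polar_angle_form_pos[OF assms(1-3)] by (simp add: D_def s_def c_def)
  have sc: "s\<^sup>2 + c\<^sup>2 = 1"
    by (simp add: s_def c_def)
  define w where "w = Complex (1 + 2 * B) (- 2 * C)"
  have w: "1 + 2 * of_real B - 2 * \<i> * of_real C = w"
    by (simp add: w_def complex_eq_iff)
  have w0: "w \<noteq> 0"
    using assms(2) by (simp add: w_def complex_eq_iff)
  define d where "d = Complex (2 * c) (4 * (B * s - C * c))"
  have nd: "(Re d)\<^sup>2 + (Im d)\<^sup>2 = 16 * B * D"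
    using assms(3) unfolding d_def D_def complex.sel by algebra
  have pos: "16 * B * D > 0"
    using assms(2) D by simp
  have d0: "d \<noteq> 0"
    using nd pos by auto
  have cis: "cis (pi - 2 * \<theta>) = - (cnj (cis \<theta>))\<^sup>2"
    by (simp add: complex_eq_iff cos_double sin_double power2_eq_square cos_diff sin_diff)
  have unit: "cis \<theta> * cnj (cis \<theta>) = 1"
    by (simp add: cis_cnj cis_mult)
  have "(1 - z * cis (pi - 2 * \<theta>)) * (cis \<theta> * w) = w * cis \<theta> + (w - 4 * of_real B) * cnj (cis \<theta>)"
  proof -
    have zw: "z * w = w - 4 * of_real B"
      unfolding z_def w using w0 by (simp add: field_simps)
    show ?thesis
      using zw unit unfolding cis by algebra
  qed
  also have "\<dots> = d"
    by (simp add: complex_eq_iff d_def w_def s_def c_def algebra_simps)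
  finally have eq: "(1 - z * cis (pi - 2 * \<theta>)) * (cis \<theta> * w) = d" .
  then have "1 - z * cis (pi - 2 * \<theta>) \<noteq> 0"
    using d0 by fastforce
  then have "1 / (1 - z * cis (pi - 2 * \<theta>)) = cis \<theta> * w / d"
    unfolding eq[symmetric] using w0 by simp
  moreover have "Re (cis \<theta> * w / d) = ((c * (1 + 2 * B) + 2 * C * s) * (2 * c)
      + (s * (1 + 2 * B) - 2 * C * c) * (4 * (B * s - C * c))) / (16 * B * D)"
    unfolding Re_divide nd by (simp add: d_def w_def s_def c_def algebra_simps)
  moreover have "2 * ((c * (1 + 2 * B) + 2 * C * s) * (2 * c)
      + (s * (1 + 2 * B) - 2 * C * c) * (4 * (B * s - C * c))) = 16 * B * D + 8 * B"
    using assms(3) sc unfolding D_def by algebra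
  ultimately have "2 * Re (1 / (1 - z * cis (pi - 2 * \<theta>))) = (16 * B * D + 8 * B) / (16 * B * D)"
    by (simp only: times_divide_eq_right)
  also have "\<dots> = 1 + 1 / (2 * D)"
    using D assms(2) by (simp add: field_simps)
  finally show ?thesis
    by (simp add: polar_angle_density_def D_def s_def c_def)
qed

section \<open>Termwise integration\<close>

text \<open>The bound \<open>norm (e x) \<le> 1\<close> makes the geometric series in \<open>u * e x\<close> converge uniformly, even
  where \<open>e x\<close> lies on the unit circle, because \<open>norm u < 1\<close>. This is what allows the sum and the
  integral to be exchanged.\<close>

lemma has_integral_geometric_series:
  fixes g e :: "real \<Rightarrow> complex"
  assumes u: "norm u < 1" and e: "\<And>x. x \<in> {a..b} \<Longrightarrow> norm (e x) \<le> 1"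
    and cont: "continuous_on {a..b} g" "continuous_on {a..b} e"
    and int: "\<And>k. ((\<lambda>x. g x * e x ^ k) has_integral c k) {a..b}"
    and sums: "(\<lambda>k. c k * u ^ k) sums S"
  shows "((\<lambda>x. g x / (1 - u * e x)) has_integral S) {a..b}"
proof -
  obtain K where K: "\<And>x. x \<in> {a..b} \<Longrightarrow> norm (g x) \<le> K"
    using compact_imp_bounded[OF compact_continuous_image[OF cont(1) compact_Icc]]
    unfolding bounded_iff by blast
  have ue: "norm (u * e x) < 1" if "x \<in> {a..b}" for x
    using u mult_left_mono[OF e[OF that], of "norm u"] by (simp add: norm_mult)
  have lim: "uniform_limit {a..b} (\<lambda>n x. \<Sum>k<n. g x * (u * e x) ^ k)
      (\<lambda>x. \<Sum>k. g x * (u * e x) ^ k) sequentially"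
  proof (rule Weierstrass_m_test)
    fix k x assume x: "x \<in> {a..b}"
    have "norm (g x * (u * e x) ^ k) = norm (g x) * (norm u ^ k * norm (e x) ^ k)"
      by (simp add: norm_mult norm_power power_mult_distrib)
    also have "\<dots> \<le> K * (norm u ^ k * 1)"
      using K[OF x] e[OF x] by (intro mult_mono power_le_one mult_nonneg_nonneg)
        (auto intro: order_trans[OF norm_ge_zero])
    finally show "norm (g x * (u * e x) ^ k) \<le> K * norm u ^ k"
      by simp
  next
    show "summable (\<lambda>k. K * norm u ^ k)"
      using u by (intro summable_mult summable_geometric) simp
  qed
  have partial: "continuous_on {a..b} (\<lambda>x. \<Sum>k<n. g x * (u * e x) ^ k)" for n
    by (intro continuous_intros cont)
  obtain I J where IJ: "\<And>n. ((\<lambda>x. \<Sum>k<n. g x * (u * e x) ^ k) has_integral I n) {a..b}"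
    "((\<lambda>x. \<Sum>k. g x * (u * e x) ^ k) has_integral J) {a..b}" "I \<longlonglongrightarrow> J"
    by (rule uniform_limit_integral[OF lim partial]) auto
  have "((\<lambda>x. g x * (u * e x) ^ k) has_integral c k * u ^ k) {a..b}" for k
    using has_integral_mult_left[OF int, of k "u ^ k"] by (simp add: power_mult_distrib mult_ac)
  then have "((\<lambda>x. \<Sum>k<n. g x * (u * e x) ^ k) has_integral (\<Sum>k<n. c k * u ^ k)) {a..b}" for n
    by (intro has_integral_sum) auto
  then have "I = (\<lambda>n. \<Sum>k<n. c k * u ^ k)"
    using IJ(1) has_integral_unique by blast
  then have "J = S"
    using IJ(3) sums LIMSEQ_unique unfolding sums_def by blast
  moreover have "(\<Sum>k. g x * (u * e x) ^ k) = g x / (1 - u * e x)" if "x \<in> {a..b}" for x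
    using sums_mult[OF geometric_sums[OF ue[OF that]], of "g x"] by (simp add: sums_iff)
  ultimately show ?thesis
    using IJ(2) by (metis (no_types, lifting) has_integral_cong)
qed

section \<open>Fourier coefficients of powers of the angle\<close>

text \<open>For \<open>k > 0\<close> put \<open>a = - 2 \<i> k\<close>. Then \<open>E\<^sup>k\<close> satisfies \<open>(E\<^sup>k)' = a E\<^sup>k\<close>, and repeated integration
  by parts gives explicit antiderivatives of \<open>\<theta>\<^sup>n E\<^sup>k\<close>. At the endpoints \<open>E\<^sup>k = 1\<close>, so only the terms
  that are odd in \<open>\<theta>\<close> survive. The index \<open>k = 0\<close> has \<open>a = 0\<close> and is integrated
  separately.\<close>

lemma cis_power_boundary:
  "cis (pi - 2 * (pi / 2)) ^ k = 1" "cis (pi - 2 * - (pi / 2)) ^ k = 1"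
proof -
  have "pi - 2 * (pi / 2) = 0" "pi - 2 * - (pi / 2) = 2 * pi"
    by simp_all
  then show "cis (pi - 2 * (pi / 2)) ^ k = 1" "cis (pi - 2 * - (pi / 2)) ^ k = 1"
    by (simp_all only: cis_zero cis_2pi power_one)
qed

lemma has_vector_derivative_cis_power:
  "((\<lambda>\<theta>. cis (pi - 2 * \<theta>) ^ k) has_vector_derivative (- 2 * \<i> * of_nat k) * cis (pi - 2 * \<theta>) ^ k)
    (at \<theta> within S)"
proof -
  have "((\<lambda>\<theta>. exp (\<i> * of_nat k * (of_real pi - 2 * of_real \<theta>)))
      has_vector_derivative (- 2 * \<i> * of_nat k) * exp (\<i> * of_nat k * (of_real pi - 2 * of_real \<theta>)))
    (at \<theta> within S)"
    by (auto intro!: derivative_eq_intros has_vector_derivative_real_field)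
  then show ?thesis
    by (simp add: cis_conv_exp exp_of_nat_mult[symmetric] mult_ac)
qed

lemma has_integral_cis_power:
  "((\<lambda>\<theta>. cis (pi - 2 * \<theta>) ^ k) has_integral (if k = 0 then of_real pi else 0)) {- (pi / 2)..pi / 2}"
proof (cases "k = 0")
  case True
  then show ?thesis
    using has_integral_const_real[of "1::complex" "- (pi / 2)" "pi / 2"] by (simp add: scaleR_conv_of_real)
next
  case False
  define a :: complex where "a = - 2 * \<i> * of_nat k"
  define E where "E = (\<lambda>\<theta>. cis (pi - 2 * \<theta>) ^ k)"
  have a: "a \<noteq> 0" using False by (simp add: a_def)
  have E: "(E has_vector_derivative a * E \<theta>) (at \<theta> within S)" for \<theta> S
    unfolding E_def a_def by (rule has_vector_derivative_cis_power)
  have ends: "E (pi / 2) = 1" "E (- (pi / 2)) = 1"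
    by (simp_all add: E_def cis_power_boundary)
  have "(E has_integral E (pi / 2) / a - E (- (pi / 2)) / a) {- (pi / 2)..pi / 2}"
    by (rule fundamental_theorem_of_calculus)
      (use a in \<open>auto intro!: derivative_eq_intros E\<close>)
  then show ?thesis
    using False by (simp add: ends) (simp add: E_def)
qed

lemma has_integral_id_times_cis_power:
  "((\<lambda>\<theta>. of_real \<theta> * cis (pi - 2 * \<theta>) ^ k) has_integral
     (if k = 0 then 0 else \<i> * of_real pi / (2 * of_nat k))) {- (pi / 2)..pi / 2}"
proof (cases "k = 0")
  case True
  have "((\<lambda>\<theta>. complex_of_real \<theta>) has_integral
      of_real (pi / 2) ^ 2 / 2 - of_real (- (pi / 2)) ^ 2 / 2) {- (pi / 2)..pi / 2}"
    by (rule fundamental_theorem_of_calculus)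
      (auto intro!: derivative_eq_intros has_vector_derivative_of_real simp: power2_eq_square)
  with True show ?thesis
    by simp
next
  case False
  define a :: complex where "a = - 2 * \<i> * of_nat k"
  define E where "E = (\<lambda>\<theta>. cis (pi - 2 * \<theta>) ^ k)"
  have a: "a \<noteq> 0" using False by (simp add: a_def)
  have E: "(E has_vector_derivative a * E \<theta>) (at \<theta> within S)" for \<theta> S
    unfolding E_def a_def by (rule has_vector_derivative_cis_power)
  have ends: "E (pi / 2) = 1" "E (- (pi / 2)) = 1"
    by (simp_all add: E_def cis_power_boundary)
  have "((\<lambda>\<theta>. of_real \<theta> * E \<theta>) has_integral
      (of_real (pi / 2) * E (pi / 2) / a - E (pi / 2) / a ^ 2) -
      (of_real (- (pi / 2)) * E (- (pi / 2)) / a - E (- (pi / 2)) / a ^ 2)) {- (pi / 2)..pi / 2}"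
    by (rule fundamental_theorem_of_calculus)
      (use a in \<open>auto intro!: derivative_eq_intros E simp: field_simps power2_eq_square\<close>)
  moreover have "(of_real (pi / 2) * E (pi / 2) / a - E (pi / 2) / a ^ 2) -
      (of_real (- (pi / 2)) * E (- (pi / 2)) / a - E (- (pi / 2)) / a ^ 2) = of_real pi / a"
    by (simp add: ends)
  moreover have "of_real pi / a = \<i> * of_real pi / (2 * of_nat k)"
    using False by (simp add: a_def field_simps)
  ultimately show ?thesis
    using False by (simp add: E_def)
qed

lemma has_integral_square_times_cis_power:
  "((\<lambda>\<theta>. of_real \<theta> ^ 2 * cis (pi - 2 * \<theta>) ^ k) has_integral
     (if k = 0 then of_real pi ^ 3 / 12 else of_real pi / (2 * of_nat k ^ 2))) {- (pi / 2)..pi / 2}"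
proof (cases "k = 0")
  case True
  have "((\<lambda>\<theta>. complex_of_real \<theta> ^ 2) has_integral
      of_real (pi / 2) ^ 3 / 3 - of_real (- (pi / 2)) ^ 3 / 3) {- (pi / 2)..pi / 2}"
    by (rule fundamental_theorem_of_calculus)
      (auto intro!: derivative_eq_intros simp: power2_eq_square power3_eq_cube)
  with True show ?thesis
    by (simp add: power3_eq_cube mult.assoc)
next
  case False
  define a :: complex where "a = - 2 * \<i> * of_nat k"
  define E where "E = (\<lambda>\<theta>. cis (pi - 2 * \<theta>) ^ k)"
  have a: "a \<noteq> 0" using False by (simp add: a_def)
  have E: "(E has_vector_derivative a * E \<theta>) (at \<theta> within S)" for \<theta> S
    unfolding E_def a_def by (rule has_vector_derivative_cis_power)
  have ends: "E (pi / 2) = 1" "E (- (pi / 2)) = 1"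
    by (simp_all add: E_def cis_power_boundary)
  define F where "F = (\<lambda>\<theta>. of_real \<theta> ^ 2 * E \<theta> / a - 2 * of_real \<theta> * E \<theta> / a ^ 2 + 2 * E \<theta> / a ^ 3)"
  have "(F has_vector_derivative of_real \<theta> ^ 2 * E \<theta>) (at \<theta> within S)" for \<theta> S
    unfolding F_def using a
    by (auto intro!: derivative_eq_intros E simp: field_simps power2_eq_square power3_eq_cube)
  then have "((\<lambda>\<theta>. of_real \<theta> ^ 2 * E \<theta>) has_integral F (pi / 2) - F (- (pi / 2))) {- (pi / 2)..pi / 2}"
    by (intro fundamental_theorem_of_calculus) auto
  moreover have "F (pi / 2) - F (- (pi / 2)) = - 2 * of_real pi / a ^ 2"
    by (simp add: F_def ends)
  moreover have "- 2 * of_real pi / a ^ 2 = of_real pi / (2 * of_nat k ^ 2)"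
    using False by (simp add: a_def power_mult_distrib)
  ultimately show ?thesis
    using False by (simp add: E_def)
qed

section \<open>Moments as power series\<close>

lemma polar_angle_moment_integrand:
  assumes "A > 0" "B > 0" "A * B - C\<^sup>2 = 1 / 4"
  shows set_integrable_polar_angle: "set_integrable lborel angle_range (\<lambda>\<theta>. \<theta> ^ n * polar_angle_density A B C \<theta>)"
    and polar_angle_moment_eq_integral:
      "polar_angle_moment A B C n = integral {- (pi / 2)..pi / 2} (\<lambda>\<theta>. \<theta> ^ n * polar_angle_density A B C \<theta>)"
proof -
  have nz: "A * (cos \<theta>)\<^sup>2 - 2 * C * sin \<theta> * cos \<theta> + B * (sin \<theta>)\<^sup>2 \<noteq> 0" for \<theta>
    using polar_angle_form_pos[OF assms, of \<theta>] by linarith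
  have "continuous_on {- (pi / 2)..pi / 2} (\<lambda>\<theta>. \<theta> ^ n * polar_angle_density A B C \<theta>)"
    unfolding polar_angle_density_def by (intro continuous_intros) (use nz in auto)
  then have "set_integrable lborel {- (pi / 2)..pi / 2} (\<lambda>\<theta>. \<theta> ^ n * polar_angle_density A B C \<theta>)"
    by (rule borel_integrable_atLeastAtMost')
  then show int: "set_integrable lborel angle_range (\<lambda>\<theta>. \<theta> ^ n * polar_angle_density A B C \<theta>)"
    by (rule set_integrable_subset) (auto simp: angle_range_def)
  show "polar_angle_moment A B C n = integral {- (pi / 2)..pi / 2} (\<lambda>\<theta>. \<theta> ^ n * polar_angle_density A B C \<theta>)"
    unfolding polar_angle_moment_def set_borel_integral_eq_integral(2)[OF int]
    by (simp add: integral_open_interval_real angle_range_def)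
qed

text \<open>The subtracted \<open>c 0\<close> is the plain integral of \<open>\<theta>\<^sup>n\<close>: it comes from the \<open>- 1\<close> in the
  Poisson kernel, which compensates for doubling the constant term of the series.\<close>

lemma polar_angle_moment_eq_series:
  assumes "A > 0" "B > 0" "A * B - C\<^sup>2 = 1 / 4"
  defines "z \<equiv> 1 - 4 * of_real B / (1 + 2 * of_real B - 2 * \<i> * of_real C) :: complex"
  assumes coeffs: "\<And>k. ((\<lambda>\<theta>. of_real \<theta> ^ n * cis (pi - 2 * \<theta>) ^ k) has_integral c k) {- (pi / 2)..pi / 2}"
    and sums: "(\<lambda>k. c k * z ^ k) sums S"
  shows "polar_angle_moment A B C n = (2 * Re S - Re (c 0)) / pi"
proof -
  have z: "norm z < 1"
    unfolding z_def using assms(2) by (rule norm_dilog_argument_less_1)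
  have "((\<lambda>\<theta>. of_real \<theta> ^ n / (1 - z * cis (pi - 2 * \<theta>))) has_integral S) {- (pi / 2)..pi / 2}"
    by (rule has_integral_geometric_series[OF z _ _ _ coeffs sums]) (simp, intro continuous_intros, simp add: cis_conv_exp, intro continuous_intros)
  from has_integral_linear[OF this bounded_linear_Re]
  have S: "((\<lambda>\<theta>. \<theta> ^ n * Re (1 / (1 - z * cis (pi - 2 * \<theta>)))) has_integral Re S) {- (pi / 2)..pi / 2}"
    by (simp add: o_def Re_divide Im_divide flip: of_real_power)
  from has_integral_linear[OF coeffs[of 0] bounded_linear_Re]
  have "((\<lambda>\<theta>. \<theta> ^ n) has_integral Re (c 0)) {- (pi / 2)..pi / 2}"
    by (simp add: o_def flip: of_real_power)
  from has_integral_divide[OF has_integral_diff[OF has_integral_mult_right[OF S, of 2] this], of pi]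
  have "((\<lambda>\<theta>. \<theta> ^ n * polar_angle_density A B C \<theta>) has_integral (2 * Re S - Re (c 0)) / pi)
      {- (pi / 2)..pi / 2}"
    unfolding polar_angle_density_eq_Poisson_kernel[OF assms(1-3), folded z_def]
    by (simp add: algebra_simps diff_divide_distrib)
  then show ?thesis
    unfolding polar_angle_moment_eq_integral[OF assms(1-3)] by (rule integral_unique)
qed

section \<open>The first three moments\<close>

lemma polar_angle_moment_0:
  assumes "A > 0" "B > 0" "A * B - C\<^sup>2 = 1 / 4"
  shows "polar_angle_moment A B C 0 = 1"
proof -
  have "(\<lambda>k. (if k = 0 then of_real pi else 0) * z ^ k) sums of_real pi" for z :: complex
    using sums_single[of 0 "\<lambda>k. of_real pi * z ^ k"] by (simp add: if_distrib if_distribR cong: if_cong)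
  from polar_angle_moment_eq_series[OF assms, of 0, OF _ this] has_integral_cis_power
  show ?thesis
    by simp
qed

lemma polar_angle_moment_1:
  assumes "A > 0" "B > 0" "A * B - C\<^sup>2 = 1 / 4"
  shows "polar_angle_moment A B C 1 = arctan (2 * C / (2 * B + 1))"
proof -
  define w where "w = Complex (1 + 2 * B) (- 2 * C)"
  have w: "1 + 2 * of_real B - 2 * \<i> * of_real C = w"
    by (simp add: w_def complex_eq_iff)
  define z where "z = 1 - 4 * of_real B / w"
  have z: "norm z < 1"
    unfolding z_def w[symmetric] using assms(2) by (rule norm_dilog_argument_less_1)
  have "(\<lambda>k. - (z ^ k) / of_nat k) sums ln (1 - z)"
    using Ln_series'[of "- z"] z by simp
  from sums_mult[OF this, of "- (\<i> * of_real pi / 2)"]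
  have "(\<lambda>k. (if k = 0 then 0 else \<i> * of_real pi / (2 * of_nat k)) * z ^ k) sums
      (- (\<i> * of_real pi / 2) * ln (1 - z))"
    by (rule sums_cong[THEN iffD1, rotated]) auto
  from polar_angle_moment_eq_series[OF assms, of 1, unfolded w, folded z_def, OF _ this]
    has_integral_id_times_cis_power
  have "polar_angle_moment A B C 1 = Im (ln (1 - z))"
    by simp
  also have "\<dots> = Im (ln (4 * of_real B / w))"
    by (simp add: z_def)
  also have "\<dots> = arctan (2 * C / (2 * B + 1))"
  proof -
    \<comment> \<open>\<open>4 B / w\<close> is the positive multiple \<open>r\<close> of the conjugate \<open>1 + 2 B + 2 \<i> C\<close> of \<open>w\<close>, so the two
      have the same argument.\<close>
    define r where "r = 4 * B / ((1 + 2 * B)\<^sup>2 + (2 * C)\<^sup>2)"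
    have r: "r > 0"
      using assms(2) by (auto simp: r_def intro!: divide_pos_pos add_pos_nonneg)
    have "Re (4 * of_real B / w) = r * (1 + 2 * B)" "Im (4 * of_real B / w) = r * (2 * C)"
      by (simp_all add: r_def w_def Re_divide Im_divide)
    moreover have "r * (1 + 2 * B) > 0"
      using r assms(2) by simp
    moreover have "r * (2 * C) / (r * (1 + 2 * B)) = 2 * C / (2 * B + 1)"
      using r by (simp add: add.commute)
    ultimately show ?thesis
      by (subst Im_Ln_eq) (auto simp: add.commute)
  qed
  finally show ?thesis .
qed

text \<open>Starting the dilogarithm series at \<open>k = 0\<close> aligns it with the Fourier coefficients; the added
  term is \<open>1 / 0 = 0\<close>.\<close>

lemma dilog_sums:
  assumes "norm z < 1"
  shows "(\<lambda>k. z ^ k / of_nat k ^ 2) sums dilog z"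
proof -
  have "summable (\<lambda>k. z ^ Suc k / of_nat (Suc k) ^ 2)"
  proof (rule summable_comparison_test)
    show "summable (\<lambda>k. norm z ^ k)"
      using assms by (simp add: summable_geometric)
    have "norm (z ^ Suc k / of_nat (Suc k) ^ 2) \<le> norm z ^ k" for k
    proof -
      have "norm (z ^ Suc k / of_nat (Suc k) ^ 2) = norm z ^ Suc k / real (Suc k) ^ 2"
        by (simp only: norm_divide norm_power norm_of_nat)
      also have "\<dots> \<le> norm z ^ Suc k / 1"
        by (intro divide_left_mono) auto
      also have "\<dots> \<le> norm z ^ k"
        using assms power_decreasing[of k "Suc k" "norm z"] by simp
      finally show ?thesis .
    qed
    then show "\<exists>N. \<forall>k\<ge>N. norm (z ^ Suc k / of_nat (Suc k) ^ 2) \<le> norm z ^ k"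
      by blast
  qed
  then have "(\<lambda>k. z ^ Suc k / of_nat (Suc k) ^ 2) sums dilog z"
    unfolding dilog_def by (rule summable_sums)
  then show ?thesis
    by (subst (asm) sums_Suc_iff) simp
qed

lemma polar_angle_moment_2:
  assumes "A > 0" "B > 0" "A * B - C\<^sup>2 = 1 / 4"
  shows "polar_angle_moment A B C 2 = pi\<^sup>2 / 12 +
    Re (dilog (1 - 4 * of_real B / (1 + 2 * of_real B - 2 * \<i> * of_real C)))"
proof -
  define z :: complex where "z = 1 - 4 * of_real B / (1 + 2 * of_real B - 2 * \<i> * of_real C)"
  have z: "norm z < 1"
    unfolding z_def using assms(2) by (rule norm_dilog_argument_less_1)
  define c :: "nat \<Rightarrow> complex" where
    "c = (\<lambda>k. if k = 0 then of_real pi ^ 3 / 12 else of_real pi / (2 * of_nat k ^ 2))"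
  \<comment> \<open>At \<open>k = 0\<close> the dilogarithm term is \<open>1 / 0 = 0\<close>, so \<open>c 0\<close> has to be supplied separately.\<close>
  have "(\<lambda>k. (if k = 0 then c 0 else 0) + of_real pi / 2 * (z ^ k / of_nat k ^ 2)) sums
      (c 0 + of_real pi / 2 * dilog z)"
    using sums_single[of 0 "\<lambda>_. c 0"] by (intro sums_add sums_mult dilog_sums z) simp
  then have "(\<lambda>k. c k * z ^ k) sums (c 0 + of_real pi / 2 * dilog z)"
    by (rule sums_cong[THEN iffD1, rotated]) (auto simp: c_def)
  from polar_angle_moment_eq_series[OF assms, of 2, folded z_def, OF _ this]
    has_integral_square_times_cis_power
  have "polar_angle_moment A B C 2 = (Re (c 0) + pi * Re (dilog z)) / pi"
    by (simp add: c_def)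
  also have "Re (c 0) = pi ^ 3 / 12"
    by (simp add: c_def flip: of_real_power)
  finally show ?thesis
    by (simp add: z_def add_divide_distrib power3_eq_cube power2_eq_square)
qed

section \<open>The distribution of the angle\<close>

text \<open>The moments were defined as integrals against Lebesgue measure; this identifies them with
  expectations under the distribution itself. The case \<open>n = 0\<close> says that the distribution has
  mass one, the cases \<open>n = 1, 2\<close> enter the variance.\<close>

lemma has_bochner_integral_polar_angle_distribution:
  assumes "A > 0" "B > 0" "A * B - C\<^sup>2 = 1 / 4"
  shows "has_bochner_integral (polar_angle_distribution A B C) (\<lambda>\<theta>. \<theta> ^ n) (polar_angle_moment A B C n)"
  unfolding polar_angle_distribution_def
proof (rule has_bochner_integral_density)
  show "(\<lambda>\<theta>. indicator angle_range \<theta> * polar_angle_density A B C \<theta>) \<in> borel_measurable lborel"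
    unfolding polar_angle_density_def angle_range_def by measurable
  show "AE \<theta> in lborel. 0 \<le> indicator angle_range \<theta> * polar_angle_density A B C \<theta>"
    using polar_angle_form_pos[OF assms] by (simp add: polar_angle_density_def less_imp_le)
  show "has_bochner_integral lborel (\<lambda>\<theta>. (indicator angle_range \<theta> * polar_angle_density A B C \<theta>) *\<^sub>R \<theta> ^ n)
      (polar_angle_moment A B C n)"
    using set_integrable_polar_angle[OF assms, of n]
    by (simp add: has_bochner_integral_iff polar_angle_moment_def set_integrable_def
        set_lebesgue_integral_def mult_ac)
qed simp

theorem theorem1:
  fixes A B C :: real
  assumes "A > 0" and "B > 0" and "A * B - C\<^sup>2 = 1 / 4"
  shows "prob_space (polar_angle_distribution A B C)
    \<and> polar_angle_moment A B C 1 = arctan (2 * C / (2 * B + 1))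
    \<and> polar_angle_moment A B C 2 =
        pi\<^sup>2 / 12 +
        Re (dilog (1 - 4 * of_real B / (1 + 2 * of_real B - 2 * \<i> * of_real C)))
    \<and> prob_space.variance (polar_angle_distribution A B C) (\<lambda>\<theta>. \<theta>) =
        polar_angle_moment A B C 2 - (polar_angle_moment A B C 1)\<^sup>2"
proof -
  let ?M = "polar_angle_distribution A B C"
  note moment = has_bochner_integral_polar_angle_distribution[OF assms]
  have "has_bochner_integral ?M (\<lambda>_. 1) (1 :: real)"
    using moment[of 0] by (simp add: polar_angle_moment_0[OF assms])
  then have int1: "integrable ?M (\<lambda>_. 1 :: real)" "(\<integral>\<theta>. 1 \<partial>?M) = (1 :: real)"
    by (auto simp: has_bochner_integral_iff)
  interpret prob_space ?M
  proof
    have "emeasure ?M (space ?M) = (\<integral>\<^sup>+\<theta>. ennreal 1 \<partial>?M)"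
      by simp
    also have "\<dots> = ennreal (\<integral>\<theta>. 1 \<partial>?M)"
      by (rule nn_integral_eq_integral[OF int1(1)]) simp
    finally show "emeasure ?M (space ?M) = 1"
      unfolding int1(2) by simp
  qed
  have "variance (\<lambda>\<theta>. \<theta>) = polar_angle_moment A B C 2 - (polar_angle_moment A B C 1)\<^sup>2"
    using moment[of 1] moment[of 2] by (subst variance_eq) (auto simp: has_bochner_integral_iff)
  then show ?thesis
    using polar_angle_moment_1[OF assms] polar_angle_moment_2[OF assms] prob_space_axioms by blast
qed

end
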